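(* Let $W$ be a nonempty set and let $(X,\|\cdot,\cdot\|_{q,\beta},\kappa)$ be a quasi-$(2,\beta)$-Banach space, $0<\beta\le 1$. Let $j\in\mathbb{N}$ and let $f_i:W\to W$ and $L_i:W\times X\to\mathbb{R}_+$ be given maps for $i=1,\ldots,j$. Let $\mathcal{T}:X^W\to X^W$ be an operator satisfying $$\|(\mathcal{T}\xi)(x)-(\mathcal{T}\mu)(x),y\|_{q,\beta}\le\sum_{i=1}^{j}L_i(x,y)\,\|\xi(f_i(x))-\mu(f_i(x)),y\|_{q,\beta}$$ for all $\xi,\mu\in X^W$ and $(x,y)\in W\times X$. Let $\Lambda:\mathbb{R}_+^{W\times X}\to\mathbb{R}_+^{W\times X}$ be defined by $$(\Lambda\delta)(x,y):=\sum_{i=1}^{j}L_i(x,y)\,\delta(f_i(x),y),\qquad \delta\in\mathbb{R}_+^{W\times X},\ (x,y)\in W\times X.$$ Put $\theta=\beta\log_{2\kappa}2$. Let $\varepsilon:W\times X\to\mathbb{R}_+$ and $\varphi:W\to X$ satisfy $$\|(\mathcal{T}\varphi)(x)-\varphi(x),y\|_{q,\beta}\le\varepsilon(x,y),\qquad (x,y)\in W\times X,$$ $$\varepsilon^{*}(x,y):=\sum_{n=0}^{\infty}\big((\Lambda^n\varepsilon)(x,y)\big)^{\theta}<\infty,\qquad (x,y)\in W\times X.$$ Then the limit $$\psi(x)=\lim_{n\to\infty}(\mathcal{T}^n\varphi)(x),\qquad x\in W,$$ exists, and the function $\psi:W\to X$ so defined is a fixed point of $\mathcal{T}$ satisfying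 $$\|\varphi(x)-\psi(x),y\|_{q,\beta}^{\theta}\le K\,\varepsilon^{*}(x,y),\qquad (x,y)\in W\times X, \qquad (\ast)$$ for some constant $K>0$. Moreover, if $$\varepsilon^{*}(x,y)\le\Big(M\sum_{n=0}^{\infty}(\Lambda^n\varepsilon)(x,y)\Big)^{\theta}<\infty,\qquad (x,y)\in W\times X,$$ for some positive real number $M$, then $\psi$ is the unique fixed point of $\mathcal{T}$ satisfying $(\ast)$.
   Context: $\mathbb{R}_+=[0,\infty)$; $\mathbb{N}$ is the set of positive integers; $\mathbb{K}$ is $\mathbb{R}$ or $\mathbb{C}$; $W^V$ denotes the set of all functions from $V$ to $W$. $\mathcal{T}^n$ and $\Lambda^n$ denote $n$-fold iterates ($\mathcal{T}^0$, $\Lambda^0$ the identity). Quasi-$(2,\beta)$-normed space: let $0<\beta\le1$ and let $X$ be a linear space over $\mathbb{K}$ with $\dim X\ge2$. A function $\|\cdot,\cdot\|_{q,\beta}:X\times X\to\mathbb{R}_+$ is a quasi-$(2,\beta)$-norm if (B1) $\|x,y\|_{q,\beta}=0$ iff $\{x,y\}$ is linearly dependent; (B2) $\|x,y\|_{q,\beta}=\|y,x\|_{q,\beta}$; (B3) $\|\lambda x,y\|_{q,\beta}=|\lambda|^{\beta}\|x,y\|_{q,\beta}$ for $\lambda\in\mathbb{K}$; (B4) there is a constant $\kappa\ge1$ with $\|x,y+z\|_{q,\beta}\le\kappa(\|x,y\|_{q,\beta}+\|x,z\|_{q,\beta})$ for all $x,y,z\in X$. The smallest possible $\kappa$ is the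 modulus of concavity, and $(X,\|\cdot,\cdot\|_{q,\beta},\kappa)$ is called a quasi-$(2,\beta)$-normed space. A sequence $\{x_n\}$ in $X$ is Cauchy if there are two linearly independent points $y,z\in X$ with $\lim_{m,n\to\infty}\|x_m-x_n,y\|_{q,\beta}=0=\lim_{m,n\to\infty}\|x_m-x_n,z\|_{q,\beta}$. It is convergent, with $\lim_{n\to\infty}x_n=x$, if there is $x\in X$ with $\lim_{n\to\infty}\|x_n-x,y\|_{q,\beta}=0$ for all $y\in X$. A quasi-$(2,\beta)$-Banach space is a quasi-$(2,\beta)$-normed space in which every Cauchy sequence is convergent. *)

theory Defs
  imports Complex_Main
begin

(* The scalar field is a type of class real_normed_field.  Both real and complex are instances,
   and by the Gelfand-Mazur theorem they are the only ones up to isometric isomorphism. *)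

(* Dependence of the family (x, y).  The library predicate "dependent" applied to the set {x, y}
   would not do: for x = y \<noteq> 0 that set is the independent singleton {x}. *)
definition lin_dep_pair :: "('k::field \<Rightarrow> 'v::ab_group_add \<Rightarrow> 'v) \<Rightarrow> 'v \<Rightarrow> 'v \<Rightarrow> bool" where
  "lin_dep_pair scale x y \<longleftrightarrow> (\<exists>a b. (a \<noteq> 0 \<or> b \<noteq> 0) \<and> scale a x + scale b y = 0)"

definition quasi_triangle :: "('v::ab_group_add \<Rightarrow> 'v \<Rightarrow> real) \<Rightarrow> real \<Rightarrow> bool" where
  "quasi_triangle q \<kappa> \<longleftrightarrow> \<kappa> \<ge> 1 \<and> (\<forall>x y z. q x (y + z) \<le> \<kappa> * (q x y + q x z))"

(* dim_ge_2 is phrased by an independent set because the library function "dim" takes the value 0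
   on infinite-dimensional spaces.  The last two assumptions say that \<kappa> is the modulus of
   concavity, i.e. the least admissible constant. *)
locale quasi_2_beta_normed_space = vector_space scale
  for scale :: "'k::real_normed_field \<Rightarrow> 'v::ab_group_add \<Rightarrow> 'v" +
  fixes \<beta> :: real and q :: "'v \<Rightarrow> 'v \<Rightarrow> real" and \<kappa> :: real
  assumes beta_pos: "0 < \<beta>"
    and beta_le_1: "\<beta> \<le> 1"
    and dim_ge_2: "\<exists>B. independent B \<and> card B = 2"
    and q_nonneg: "0 \<le> q x y"
    and q_eq_0_iff: "q x y = 0 \<longleftrightarrow> lin_dep_pair scale x y"
    and q_commute: "q x y = q y x"
    and q_scale: "q (scale c x) y = norm c powr \<beta> * q x y"
    and q_triangle: "quasi_triangle q \<kappa>"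
    and kappa_least: "quasi_triangle q k \<Longrightarrow> \<kappa> \<le> k"

definition Cauchy2 ::
  "('k::field \<Rightarrow> 'v::ab_group_add \<Rightarrow> 'v) \<Rightarrow> ('v \<Rightarrow> 'v \<Rightarrow> real) \<Rightarrow> (nat \<Rightarrow> 'v) \<Rightarrow> bool" where
  "Cauchy2 scale q X \<longleftrightarrow> (\<exists>y z. \<not> lin_dep_pair scale y z \<and>
     ((\<lambda>(m, n). q (X m - X n) y) \<longlongrightarrow> 0) (sequentially \<times>\<^sub>F sequentially) \<and>
     ((\<lambda>(m, n). q (X m - X n) z) \<longlongrightarrow> 0) (sequentially \<times>\<^sub>F sequentially))"

definition tendsto2 ::
  "('v::ab_group_add \<Rightarrow> 'v \<Rightarrow> real) \<Rightarrow> (nat \<Rightarrow> 'v) \<Rightarrow> 'v \<Rightarrow> bool" where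
  "tendsto2 q X l \<longleftrightarrow> (\<forall>y. (\<lambda>n. q (X n - l) y) \<longlonglongrightarrow> 0)"

locale quasi_2_beta_Banach_space = quasi_2_beta_normed_space +
  assumes complete: "Cauchy2 scale q X \<Longrightarrow> \<exists>l. tendsto2 q X l"

definition Lam ::
  "nat \<Rightarrow> (nat \<Rightarrow> 'w \<Rightarrow> 'w) \<Rightarrow> (nat \<Rightarrow> 'w \<Rightarrow> 'v \<Rightarrow> real)
    \<Rightarrow> ('w \<Rightarrow> 'v \<Rightarrow> real) \<Rightarrow> ('w \<Rightarrow> 'v \<Rightarrow> real)" where
  "Lam j f L \<delta> x y = (\<Sum>i=1..j. L i x y * \<delta> (f i x) y)"

(* The series is meaningful only where it is summable; the theorem assumes this everywhere. *)
definition eps_star ::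
  "real \<Rightarrow> nat \<Rightarrow> (nat \<Rightarrow> 'w \<Rightarrow> 'w) \<Rightarrow> (nat \<Rightarrow> 'w \<Rightarrow> 'v \<Rightarrow> real)
    \<Rightarrow> ('w \<Rightarrow> 'v \<Rightarrow> real) \<Rightarrow> 'w \<Rightarrow> 'v \<Rightarrow> real" where
  "eps_star \<theta> j f L \<epsilon> x y = (\<Sum>n. (((Lam j f L) ^^ n) \<epsilon> x y) powr \<theta>)"

end

theory Submission
  imports Defs
begin

text \<open>
  For fixed \<open>y\<close> the function \<open>z \<mapsto> (q z y) powr \<theta>\<close> satisfies \<open>D (a + b) \<le> 2 * max (D a) (D b)\<close>, because
  \<open>(2 * \<kappa>) powr \<theta> = 2 powr \<beta> \<le> 2\<close>.  Along any chain this yields a triangle inequality up to the factor 4,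
  so the orbit of \<open>\<phi>\<close>, whose steps are bounded by \<open>\<Lambda>\<^sup>n \<epsilon>\<close>, is Cauchy.  If \<open>\<xi>\<close> is another fixed point, its
  distance to \<open>\<phi>\<close> is at most \<open>C \<Sum>\<^sub>n \<Lambda>\<^sup>n \<epsilon>\<close>; since \<open>\<Lambda>\<close> commutes with the series, the distance from
  the \<open>m\<close>-th iterate to \<open>\<xi>\<close> is at most \<open>C\<close> times the \<open>m\<close>-th tail, which tends to 0.
\<close>

section \<open>Chain inequality from a two-term maximum bound\<close>

text \<open>Halving the end terms is what makes the induction close: the two overlapping pieces
  \<open>m..Suc p\<close> and \<open>p..n\<close> share exactly the term \<open>d p (Suc p)\<close>.\<close>

lemma chain_inequality_ends:
  fixes d :: "nat \<Rightarrow> nat \<Rightarrow> real"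
  assumes max: "\<And>i j k. i < j \<Longrightarrow> j < k \<Longrightarrow> d i k \<le> 2 * max (d i j) (d j k)"
    and nonneg: "\<And>i j. 0 \<le> d i j"
    and "m + 2 \<le> n"
  shows "d m n \<le> 4 * (\<Sum>i=m..<n. d i (Suc i)) - 2 * d m (Suc m) - 2 * d (n - 1) n"
  using \<open>m + 2 \<le> n\<close>
proof (induction "n - m" arbitrary: m n rule: less_induct)
  case less
  let ?S = "\<lambda>m n. \<Sum>i=m..<n. d i (Suc i)"
  \<comment> \<open>The chain is cut at the last point \<open>p\<close> whose distance to
    \<open>n\<close> is still at least half of \<open>d m n\<close>; \<open>m\<close> itself
    qualifies by nonnegativity.\<close>
  define P where "P p \<longleftrightarrow> m \<le> p \<and> p < n \<and> d m n \<le> 2 * d p n" for p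
  \<comment> \<open>Since \<open>m + 2 \<le> n\<close>, the first and last steps are different terms
    of the sum, so the claimed bound is at least twice their total. This settles
    \<open>p = n - 1\<close> and \<open>p = m\<close>, where one piece is a single step and the
    induction hypothesis does not apply.\<close>
  have S_ge_first: "d m (Suc m) + d (n - 1) n \<le> ?S m n"
  proof -
    have "?S m n = d m (Suc m) + ?S (Suc m) (n - 1) + d (n - 1) n"
      using less.prems sum.atLeast_Suc_lessThan[of m n "\<lambda>i. d i (Suc i)"]
        sum.atLeastLessThan_Suc[of "Suc m" "n - 1" "\<lambda>i. d i (Suc i)"] by simp
    then show ?thesis
      using sum_nonneg[of "{Suc m..<n - 1}" "\<lambda>i. d i (Suc i)"] nonneg by simp
  qed
  have Pm: "P m"
    using less.prems nonneg[of m n] by (simp add: P_def)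
  have bound: "\<forall>p. P p \<longrightarrow> p \<le> n"
    by (simp add: P_def)
  define p where "p = (GREATEST p. P p)"
  have Pp: "P p"
    unfolding p_def using GreatestI_nat[of P m n] Pm bound by blast
  have p_max: "\<And>r. P r \<Longrightarrow> r \<le> p"
    unfolding p_def using Greatest_le_nat[of P _ n] bound by blast
  show ?case
  proof (cases "p = n - 1")
    case True
    then have "d m n \<le> 2 * d (n - 1) n"
      using Pp by (simp add: P_def)
    then show ?thesis
      using S_ge_first nonneg[of m "Suc m"] nonneg[of "n - 1" n] by linarith
  next
    case False
    then have "Suc p < n" "m \<le> p"
      using Pp by (auto simp: P_def)
    moreover have "\<not> P (Suc p)"
      using p_max by fastforce
    \<comment> \<open>At \<open>Suc p\<close> the right piece is too short by maximality of
      \<open>p\<close>, so the left piece must carry the maximum.\<close>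
    ultimately have left: "d m n \<le> 2 * d m (Suc p)"
      using max[of m "Suc p" n] by (auto simp: P_def max_def split: if_splits)
    show ?thesis
    proof (cases "p = m")
      case True
      then show ?thesis
        using left S_ge_first nonneg[of m "Suc m"] nonneg[of "n - 1" n] by simp
    next
      case False
      then have "m < p" using \<open>m \<le> p\<close> by simp
      have "d m (Suc p) \<le> 4 * ?S m (Suc p) - 2 * d m (Suc m) - 2 * d p (Suc p)"
        using less.hyps[of "Suc p" m] \<open>m < p\<close> \<open>Suc p < n\<close> by simp
      moreover have "d p n \<le> 4 * ?S p n - 2 * d p (Suc p) - 2 * d (n - 1) n"
        using less.hyps[of n p] \<open>m < p\<close> \<open>Suc p < n\<close> by simp
      moreover have "?S m (Suc p) + ?S p n = ?S m n + d p (Suc p)"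
        using sum.atLeastLessThan_concat[of m p n "\<lambda>i. d i (Suc i)"] \<open>m < p\<close> \<open>Suc p < n\<close> by simp
      moreover have "d m n \<le> 2 * d p n"
        using Pp by (simp add: P_def)
      \<comment> \<open>Averaging the two bounds on \<open>d m n\<close> gives
        \<open>d m n \<le> d m (Suc p) + d p n\<close> with no factor lost. The two deductions
        \<open>2 * d p (Suc p)\<close> cancel the double count of that step.\<close>
      ultimately show ?thesis
        using left by (simp add: algebra_simps)
    qed
  qed
qed

lemma chain_inequality:
  fixes d :: "nat \<Rightarrow> nat \<Rightarrow> real"
  assumes max: "\<And>i j k. i < j \<Longrightarrow> j < k \<Longrightarrow> d i k \<le> 2 * max (d i j) (d j k)"
    and nonneg: "\<And>i j. 0 \<le> d i j"
    and "m < n"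
  shows "d m n \<le> 4 * (\<Sum>i=m..<n. d i (Suc i))"
proof (cases "n = Suc m")
  case True
  then show ?thesis using nonneg[of m n] by simp
next
  case False
  then have "d m n \<le> 4 * (\<Sum>i=m..<n. d i (Suc i)) - 2 * d m (Suc m) - 2 * d (n - 1) n"
    using \<open>m < n\<close> by (intro chain_inequality_ends max nonneg) auto
  then show ?thesis
    using nonneg[of m "Suc m"] nonneg[of "n - 1" n] by linarith
qed

section \<open>Tails of series and the operator \<open>Lam\<close>\<close>

lemma suminf_tail_tendsto_0:
  fixes a :: "nat \<Rightarrow> real"
  assumes "summable a"
  shows "(\<lambda>m. \<Sum>n. a (n + m)) \<longlonglongrightarrow> 0"
proof -
  have "(\<lambda>m. suminf a - sum a {..<m}) \<longlonglongrightarrow> suminf a - suminf a"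
    by (intro tendsto_intros summable_LIMSEQ assms)
  then show ?thesis
    using assms by (simp add: suminf_minus_initial_segment)
qed

lemma tendsto_0_squeeze:
  fixes a b :: "nat \<Rightarrow> real"
  assumes "b \<longlonglongrightarrow> 0" "\<And>n. 0 \<le> a n" "\<And>n. a n \<le> b n"
  shows "a \<longlonglongrightarrow> 0"
  by (rule tendsto_sandwich[OF _ _ tendsto_const assms(1)]) (simp_all add: assms(2,3))

lemma Lam_mono:
  assumes "\<And>i x y. i \<in> {1..j} \<Longrightarrow> 0 \<le> L i x y" "\<And>x y. \<delta> x y \<le> \<delta>' x y"
  shows "Lam j f L \<delta> x y \<le> Lam j f L \<delta>' x y"
  unfolding Lam_def by (intro sum_mono mult_left_mono assms)

lemma Lam_pow_mono:
  assumes "\<And>i x y. i \<in> {1..j} \<Longrightarrow> 0 \<le> L i x y" "\<And>x y. \<delta> x y \<le> \<delta>' x y"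
  shows "(Lam j f L ^^ m) \<delta> x y \<le> (Lam j f L ^^ m) \<delta>' x y"
proof (induction m arbitrary: x y)
  case (Suc m)
  show ?case
    unfolding funpow.simps comp_def by (rule Lam_mono[OF assms(1) Suc.IH])
qed (simp add: assms(2))

lemma Lam_pow_nonneg:
  assumes "\<And>i x y. i \<in> {1..j} \<Longrightarrow> 0 \<le> L i x y" "\<And>x y. 0 \<le> \<delta> x y"
  shows "0 \<le> (Lam j f L ^^ m) \<delta> x y"
proof (induction m arbitrary: x y)
  case (Suc m)
  then show ?case
    unfolding funpow.simps comp_def Lam_def[of j f L "(Lam j f L ^^ m) \<delta>"]
    by (intro sum_nonneg mult_nonneg_nonneg assms(1))
qed (simp add: assms)

text \<open>\<open>Lam j f L\<close> is a finite linear combination of values, so it can be applied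
  to the series term by term, and each application shifts the index by one. A full series thereby
  becomes its \<open>m\<close>-th tail.\<close>

lemma Lam_pow_suminf:
  assumes "\<And>x y. summable (\<lambda>n. (Lam j f L ^^ n) \<epsilon> x y)"
  shows "(Lam j f L ^^ m) (\<lambda>x y. C * (\<Sum>n. (Lam j f L ^^ n) \<epsilon> x y)) x y
    = C * (\<Sum>n. (Lam j f L ^^ (n + m)) \<epsilon> x y)"
proof (induction m arbitrary: x y)
  case (Suc m)
  have sm: "summable (\<lambda>n. (Lam j f L ^^ (n + m)) \<epsilon> x y)" for x y
    using assms by (rule summable_ignore_initial_segment)
  have "(Lam j f L ^^ Suc m) (\<lambda>x y. C * (\<Sum>n. (Lam j f L ^^ n) \<epsilon> x y)) x y
      = Lam j f L (\<lambda>x y. C * (\<Sum>n. (Lam j f L ^^ (n + m)) \<epsilon> x y)) x y"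
    unfolding funpow.simps comp_def by (intro arg_cong[where f = "\<lambda>\<delta>. Lam j f L \<delta> x y"] ext Suc.IH)
  also have "\<dots> = C * (\<Sum>i=1..j. \<Sum>n. L i x y * (Lam j f L ^^ (n + m)) \<epsilon> (f i x) y)"
    by (simp add: Lam_def sum_distrib_left suminf_mult sm mult.left_commute)
  also have "\<dots> = C * (\<Sum>n. \<Sum>i=1..j. L i x y * (Lam j f L ^^ (n + m)) \<epsilon> (f i x) y)"
    by (subst suminf_sum) (auto intro: summable_mult sm)
  also have "\<dots> = C * (\<Sum>n. (Lam j f L ^^ (n + Suc m)) \<epsilon> x y)"
    by (simp add: Lam_def)
  finally show ?case .
qed simp

section \<open>Separation of points and uniqueness of limits\<close>

context quasi_2_beta_normed_space
begin

lemma q_minus: "q (- x) y = q x y"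
  using q_scale[of "- 1" x y] by simp

lemma q_diff_commute: "q (a - b) y = q (b - a) y"
  using q_minus[of "a - b" y] by simp

lemma kappa_ge_1: "1 \<le> \<kappa>"
  using q_triangle by (simp add: quasi_triangle_def)

lemma q_triangle_diff: "q (a - c) y \<le> \<kappa> * (q (a - b) y + q (b - c) y)"
proof -
  have "q y ((a - b) + (b - c)) \<le> \<kappa> * (q y (a - b) + q y (b - c))"
    using q_triangle unfolding quasi_triangle_def by blast
  then show ?thesis
    by (simp add: q_commute[of y])
qed

text \<open>\<open>card B = 2\<close> provides two distinct vectors; distinctness is what turns
  independence of the set into independence of the pair.\<close>

lemma independent_pair_exists: "\<exists>u v. \<not> lin_dep_pair scale u v"
proof -
  obtain B where B: "independent B" "card B = 2"
    using dim_ge_2 by blast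
  then obtain u v where uv: "B = {u, v}" "u \<noteq> v"
    by (auto simp: card_2_iff)
  have "a = 0 \<and> b = 0" if "scale a u + scale b v = 0" for a b
  proof -
    have sum: "(\<Sum>w\<in>B. scale (if w = u then a else b) w) = 0"
      using uv that by simp
    have "finite B" using uv by simp
    show ?thesis
      using independentD[OF B(1) \<open>finite B\<close> subset_refl sum, of u]
        independentD[OF B(1) \<open>finite B\<close> subset_refl sum, of v] uv by simp
  qed
  then show ?thesis
    unfolding lin_dep_pair_def by blast
qed

text \<open>A nonzero vector dependent on every vector would span the whole space, contradicting
  dimension at least 2.\<close>

lemma q_separates:
  assumes "\<And>y. q x y = 0"
  shows "x = 0"
proof (rule ccontr)
  assume "x \<noteq> 0"
  have multiple: "\<exists>c. w = scale c x" for w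
  proof -
    obtain a b where ab: "a \<noteq> 0 \<or> b \<noteq> 0" "scale a x + scale b w = 0"
      using assms[of w] by (auto simp: q_eq_0_iff lin_dep_pair_def)
    have "b \<noteq> 0"
      using ab \<open>x \<noteq> 0\<close> by auto
    have "scale b w = scale (- a) x"
      using ab(2) by (simp add: add_eq_0_iff)
    then have "scale (inverse b) (scale b w) = scale (inverse b) (scale (- a) x)"
      by simp
    then show ?thesis
      using \<open>b \<noteq> 0\<close> by (auto simp del: scale_minus_left)
  qed
  obtain u v where uv: "\<not> lin_dep_pair scale u v"
    using independent_pair_exists by blast
  obtain c d where cd: "u = scale c x" "v = scale d x"
    using multiple by blast
  show False
  proof (cases "c = 0")
    case True
    then have "scale 1 u + scale 0 v = 0" using cd by simp
    then show ?thesis using uv unfolding lin_dep_pair_def by (metis one_neq_zero)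
  next
    case False
    have "scale d u + scale (- c) v = 0"
      using cd by (simp add: mult.commute)
    then show ?thesis using uv False unfolding lin_dep_pair_def by (metis neg_equal_0_iff_equal)
  qed
qed

lemma tendsto2_unique:
  assumes "tendsto2 q X a" "tendsto2 q X b"
  shows "a = b"
proof -
  have "q (a - b) y = 0" for y
  proof -
    have "(\<lambda>n. \<kappa> * (q (X n - a) y + q (X n - b) y)) \<longlonglongrightarrow> \<kappa> * (0 + 0)"
      using assms unfolding tendsto2_def by (intro tendsto_intros) auto
    moreover have "q (a - b) y \<le> \<kappa> * (q (X n - a) y + q (X n - b) y)" for n
      using q_triangle_diff[of a b y "X n"] by (simp add: q_diff_commute[of a "X n"])
    ultimately have "q (a - b) y \<le> \<kappa> * (0 + 0)"
      by (intro tendsto_lowerbound) (auto intro: always_eventually)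
    then show ?thesis
      using q_nonneg[of "a - b" y] by simp
  qed
  then show ?thesis
    using q_separates[of "a - b"] by simp
qed

section \<open>Powers of the quasi-norm along sequences\<close>

context
  fixes \<theta> :: real
  assumes theta: "\<theta> = \<beta> * log (2 * \<kappa>) 2"
begin

lemma theta_pos: "0 < \<theta>"
  using theta beta_pos kappa_ge_1 by simp

lemma q_powr_diff_le_max:
  "q (a - c) y powr \<theta> \<le> 2 * max (q (a - b) y powr \<theta>) (q (b - c) y powr \<theta>)"
proof -
  \<comment> \<open>Replacing the sum by twice its larger term adds a factor 2 to
    \<open>\<kappa>\<close>, whence the base \<open>2 * \<kappa>\<close> in
    \<open>\<theta>\<close>.\<close>
  define s where "s = max (q (a - b) y) (q (b - c) y)"
  have s: "0 \<le> s" "s powr \<theta> = max (q (a - b) y powr \<theta>) (q (b - c) y powr \<theta>)"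
    using theta_pos q_nonneg
    by (auto simp: s_def max_def powr_mono2 less_imp_le intro!: antisym powr_mono2)
  have "q (a - b) y + q (b - c) y \<le> 2 * s"
    by (simp add: s_def)
  then have "\<kappa> * (q (a - b) y + q (b - c) y) \<le> \<kappa> * (2 * s)"
    using kappa_ge_1 by (intro mult_left_mono) auto
  then have "q (a - c) y \<le> (2 * \<kappa>) * s"
    using q_triangle_diff[of a c y b] by (simp add: mult.assoc mult.left_commute)
  then have "q (a - c) y powr \<theta> \<le> ((2 * \<kappa>) * s) powr \<theta>"
    using theta_pos q_nonneg by (intro powr_mono2) auto
  also have "\<dots> = (2 * \<kappa>) powr \<theta> * s powr \<theta>"
    using kappa_ge_1 s by (simp add: powr_mult)
  also have "(2 * \<kappa>) powr \<theta> = 2 powr \<beta>"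
    using kappa_ge_1 by (simp add: theta mult.commute[of \<beta>] powr_powr[symmetric])
  also have "2 powr \<beta> * s powr \<theta> \<le> 2 * s powr \<theta>"
    using beta_le_1 powr_mono[of \<beta> 1 2] by (intro mult_right_mono) auto
  finally show ?thesis
    using s by simp
qed

lemma q_powr_chain:
  assumes "m \<le> n"
  shows "q (X m - X n) y powr \<theta> \<le> 4 * (\<Sum>i=m..<n. q (X (Suc i) - X i) y powr \<theta>)"
proof (cases "m = n")
  case True
  \<comment> \<open>Homogeneity with scalar 0, as \<open>0 powr \<beta>\<close> is 0.\<close>
  have "q 0 y = 0"
    using q_triangle_diff beta_pos q_scale[of 0 0 y] by simp
  then show ?thesis using True by simp
next
  case False
  then show ?thesis
    using chain_inequality[of "\<lambda>i j. q (X i - X j) y powr \<theta>" m n] q_powr_diff_le_max assms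
    by (simp add: q_diff_commute[of "X (Suc _)"])
qed

lemma Cauchy2_of_summable_steps:
  assumes steps: "\<And>n y. q (X (Suc n) - X n) y \<le> a n y"
    and summable: "\<And>y. summable (\<lambda>n. a n y powr \<theta>)"
  shows "Cauchy2 scale q X"
proof -
  have *: "((\<lambda>(m, n). q (X m - X n) y) \<longlongrightarrow> 0) (sequentially \<times>\<^sub>F sequentially)" for y
  proof (rule tendstoI)
    fix r :: real assume "0 < r"
    \<comment> \<open>The 4 absorbs the chain factor; the exponent appears because the chain bound
      concerns \<open>\<theta>\<close>-th powers.\<close>
    then obtain N where N: "\<And>m n. N \<le> m \<Longrightarrow> norm (\<Sum>i=m..<n. a i y powr \<theta>) < r powr \<theta> / 4"
      using summable[of y] unfolding summable_Cauchy
      by (metis divide_pos_pos powr_gt_zero less_irrefl zero_less_numeral)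
    have less: "q (X m - X n) y < r" if "N \<le> m" "m \<le> n" for m n
    proof -
      have "q (X m - X n) y powr \<theta> \<le> 4 * (\<Sum>i=m..<n. q (X (Suc i) - X i) y powr \<theta>)"
        using that by (intro q_powr_chain)
      also have "\<dots> \<le> 4 * (\<Sum>i=m..<n. a i y powr \<theta>)"
        using steps theta_pos q_nonneg by (intro mult_left_mono sum_mono powr_mono2) auto
      also have "\<dots> < r powr \<theta>"
        using N[of m n] that by simp
      finally show ?thesis
        using powr_mono2[of \<theta> r "q (X m - X n) y"] theta_pos \<open>0 < r\<close>
        by (meson less_imp_le not_le)
    qed
    then have "q (X m - X n) y < r" if "N \<le> m" "N \<le> n" for m n
      using that q_diff_commute[of "X m" "X n"] by (metis nle_le)
    then show "\<forall>\<^sub>F z in sequentially \<times>\<^sub>F sequentially. dist (case z of (m, n) \<Rightarrow> q (X m - X n) y) 0 < r"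
      unfolding eventually_prod_sequentially using q_nonneg by auto
  qed
  \<comment> \<open>The differences vanish in every direction \<open>y\<close>, so any independent
    pair is a witness.\<close>
  then show ?thesis
    using independent_pair_exists unfolding Cauchy2_def by blast
qed

text \<open>A quasi-norm need not be continuous, so the chain bound is not carried to the limit
  directly. One more maximum step, from \<open>X n\<close> to \<open>l\<close>, doubles the chain
  factor 4 to 8, and its remainder vanishes with \<open>n\<close>.\<close>

lemma q_powr_limit_bound:
  assumes steps: "\<And>n. q (X (Suc n) - X n) y \<le> a n"
    and summable: "summable (\<lambda>n. a n powr \<theta>)"
    and lim: "tendsto2 q X l"
  shows "q (X 0 - l) y powr \<theta> \<le> 8 * (\<Sum>n. a n powr \<theta>)"
proof -
  let ?E = "\<Sum>n. a n powr \<theta>"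
  have bound: "q (X 0 - l) y powr \<theta> \<le> 8 * ?E + 2 * q (X n - l) y powr \<theta>" for n
  proof -
    have "q (X 0 - X n) y powr \<theta> \<le> 4 * (\<Sum>i=0..<n. q (X (Suc i) - X i) y powr \<theta>)"
      by (intro q_powr_chain) simp
    also have "\<dots> \<le> 4 * (\<Sum>i=0..<n. a i powr \<theta>)"
      using steps theta_pos q_nonneg by (intro mult_left_mono sum_mono powr_mono2) auto
    also have "\<dots> \<le> 4 * ?E"
      using summable by (intro mult_left_mono sum_le_suminf) auto
    finally have "q (X 0 - X n) y powr \<theta> \<le> 4 * ?E" .
    moreover have "0 \<le> ?E"
      using summable by (intro suminf_nonneg) auto
    ultimately have "max (q (X 0 - X n) y powr \<theta>) (q (X n - l) y powr \<theta>)
        \<le> 4 * ?E + q (X n - l) y powr \<theta>"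
      by (simp add: add_increasing2)
    then show ?thesis
      using q_powr_diff_le_max[of "X 0" l y "X n"] by linarith
  qed
  have "(\<lambda>n. q (X n - l) y powr \<theta>) \<longlonglongrightarrow> 0"
    using lim theta_pos q_nonneg unfolding tendsto2_def
    by (intro tendsto_zero_powrI[where b = \<theta>]) auto
  then have "(\<lambda>n. 8 * ?E + 2 * q (X n - l) y powr \<theta>) \<longlonglongrightarrow> 8 * ?E + 2 * 0"
    by (intro tendsto_intros)
  then show ?thesis
    using bound by (intro tendsto_lowerbound[of _ "8 * ?E" sequentially]) (auto intro: always_eventually)
qed

end

section \<open>Orbits and fixed points of \<open>T\<close>\<close>

context
  fixes j :: nat and f :: "nat \<Rightarrow> 'w \<Rightarrow> 'w" and L :: "nat \<Rightarrow> 'w \<Rightarrow> 'v \<Rightarrow> real"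
    and T :: "('w \<Rightarrow> 'v) \<Rightarrow> ('w \<Rightarrow> 'v)"
  assumes L_nonneg: "\<And>i x y. i \<in> {1..j} \<Longrightarrow> 0 \<le> L i x y"
    and T_bound: "\<And>\<xi> \<mu> x y. q (T \<xi> x - T \<mu> x) y \<le> (\<Sum>i=1..j. L i x y * q (\<xi> (f i x) - \<mu> (f i x)) y)"
begin

text \<open>Distances after \<open>T\<close> are dominated by \<open>Lam\<close> of the distances
  before; nonnegative \<open>L\<close> makes \<open>Lam\<close> monotone, so the domination
  iterates.\<close>

lemma T_pow_bound:
  "q ((T ^^ m) \<xi> x - (T ^^ m) \<mu> x) y \<le> (Lam j f L ^^ m) (\<lambda>x y. q (\<xi> x - \<mu> x) y) x y"
proof (induction m arbitrary: x y)
  case (Suc m)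
  have "q ((T ^^ Suc m) \<xi> x - (T ^^ Suc m) \<mu> x) y
      \<le> Lam j f L (\<lambda>x y. q ((T ^^ m) \<xi> x - (T ^^ m) \<mu> x) y) x y"
    using T_bound by (simp add: Lam_def)
  also have "\<dots> \<le> Lam j f L ((Lam j f L ^^ m) (\<lambda>x y. q (\<xi> x - \<mu> x) y)) x y"
    by (intro Lam_mono L_nonneg Suc.IH)
  finally show ?case by simp
qed simp

lemma T_orbit_step:
  assumes "\<And>x y. q (T \<phi> x - \<phi> x) y \<le> \<epsilon> x y"
  shows "q ((T ^^ Suc n) \<phi> x - (T ^^ n) \<phi> x) y \<le> (Lam j f L ^^ n) \<epsilon> x y"
proof -
  have "q ((T ^^ n) (T \<phi>) x - (T ^^ n) \<phi> x) y \<le> (Lam j f L ^^ n) (\<lambda>x y. q (T \<phi> x - \<phi> x) y) x y"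
    by (rule T_pow_bound)
  also have "\<dots> \<le> (Lam j f L ^^ n) \<epsilon> x y"
    by (intro Lam_pow_mono L_nonneg assms)
  finally show ?thesis
    by (simp add: funpow_swap1)
qed

text \<open>The shifted orbit tends to \<open>\<psi> x\<close>, and also to
  \<open>T \<psi> x\<close> because the bound on \<open>T\<close> is a finite sum of null sequences;
  limits are unique.\<close>

lemma orbit_limit_fixed:
  assumes lim: "\<And>x. tendsto2 q (\<lambda>n. (T ^^ n) \<phi> x) (\<psi> x)"
  shows "T \<psi> = \<psi>"
proof
  fix x
  have "tendsto2 q (\<lambda>n. (T ^^ Suc n) \<phi> x) (T \<psi> x)"
    unfolding tendsto2_def
  proof
    fix y
    have "(\<lambda>n. \<Sum>i=1..j. L i x y * q ((T ^^ n) \<phi> (f i x) - \<psi> (f i x)) y)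
        \<longlonglongrightarrow> (\<Sum>i=1..j. L i x y * 0)"
      using lim unfolding tendsto2_def by (intro tendsto_intros) auto
    then have "(\<lambda>n. \<Sum>i=1..j. L i x y * q ((T ^^ n) \<phi> (f i x) - \<psi> (f i x)) y) \<longlonglongrightarrow> 0"
      by simp
    then show "(\<lambda>n. q ((T ^^ Suc n) \<phi> x - T \<psi> x) y) \<longlonglongrightarrow> 0"
      unfolding funpow.simps comp_def using q_nonneg T_bound by (rule tendsto_0_squeeze)
  qed
  moreover have "tendsto2 q (\<lambda>n. (T ^^ Suc n) \<phi> x) (\<psi> x)"
    unfolding tendsto2_def
  proof
    fix y
    show "(\<lambda>n. q ((T ^^ Suc n) \<phi> x - \<psi> x) y) \<longlonglongrightarrow> 0"
      using lim[of x] by (intro LIMSEQ_Suc[where f = "\<lambda>n. q ((T ^^ n) \<phi> x - \<psi> x) y"])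
        (simp add: tendsto2_def)
  qed
  ultimately show "T \<psi> x = \<psi> x"
    by (rule tendsto2_unique)
qed

text \<open>Iterating \<open>T\<close> moves \<open>\<phi>\<close> but leaves \<open>\<xi>\<close>
  in place, so the assumed bound by the full series improves to one by its \<open>m\<close>-th
  tail.\<close>

lemma orbit_tendsto_fixed_point:
  assumes summable: "\<And>x y. summable (\<lambda>n. (Lam j f L ^^ n) \<epsilon> x y)"
    and bound: "\<And>x y. q (\<phi> x - \<xi> x) y \<le> C * (\<Sum>n. (Lam j f L ^^ n) \<epsilon> x y)"
    and fixed: "T \<xi> = \<xi>"
  shows "tendsto2 q (\<lambda>n. (T ^^ n) \<phi> x) (\<xi> x)"
  unfolding tendsto2_def
proof
  fix y
  have fixed_pow: "(T ^^ m) \<xi> = \<xi>" for m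
    by (induction m) (simp_all add: fixed)
  have le: "q ((T ^^ m) \<phi> x - \<xi> x) y \<le> C * (\<Sum>n. (Lam j f L ^^ (n + m)) \<epsilon> x y)" for m
  proof -
    have "q ((T ^^ m) \<phi> x - (T ^^ m) \<xi> x) y \<le> (Lam j f L ^^ m) (\<lambda>x y. q (\<phi> x - \<xi> x) y) x y"
      by (rule T_pow_bound)
    also have "\<dots> \<le> (Lam j f L ^^ m) (\<lambda>x y. C * (\<Sum>n. (Lam j f L ^^ n) \<epsilon> x y)) x y"
      by (intro Lam_pow_mono L_nonneg bound)
    also have "\<dots> = C * (\<Sum>n. (Lam j f L ^^ (n + m)) \<epsilon> x y)"
      by (rule Lam_pow_suminf) (rule summable)
    finally show ?thesis
      by (simp add: fixed_pow)
  qed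
  have "(\<lambda>m. C * (\<Sum>n. (Lam j f L ^^ (n + m)) \<epsilon> x y)) \<longlonglongrightarrow> 0"
    by (intro tendsto_mult_right_zero suminf_tail_tendsto_0 summable)
  then show "(\<lambda>m. q ((T ^^ m) \<phi> x - \<xi> x) y) \<longlonglongrightarrow> 0"
    using q_nonneg le by (rule tendsto_0_squeeze)
qed

end

end

section \<open>Existence, error estimate and uniqueness of the fixed point\<close>

theorem theorem3p1:
  fixes scale :: "'k::real_normed_field \<Rightarrow> 'v::ab_group_add \<Rightarrow> 'v"
    and \<beta> \<kappa> \<theta> :: real
    and q :: "'v \<Rightarrow> 'v \<Rightarrow> real"
    and j :: nat
    and f :: "nat \<Rightarrow> 'w \<Rightarrow> 'w"
    and L :: "nat \<Rightarrow> 'w \<Rightarrow> 'v \<Rightarrow> real"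
    and T :: "('w \<Rightarrow> 'v) \<Rightarrow> ('w \<Rightarrow> 'v)"
    and \<epsilon> :: "'w \<Rightarrow> 'v \<Rightarrow> real"
    and \<phi> :: "'w \<Rightarrow> 'v"
  assumes "quasi_2_beta_Banach_space scale \<beta> q \<kappa>"
    and "1 \<le> j"
    and "\<And>i x y. i \<in> {1..j} \<Longrightarrow> 0 \<le> L i x y"
    and "\<And>\<xi> \<mu> x y. q (T \<xi> x - T \<mu> x) y \<le> (\<Sum>i=1..j. L i x y * q (\<xi> (f i x) - \<mu> (f i x)) y)"
    and "\<theta> = \<beta> * log (2 * \<kappa>) 2"
    and "\<And>x y. 0 \<le> \<epsilon> x y"
    and "\<And>x y. q (T \<phi> x - \<phi> x) y \<le> \<epsilon> x y"
    and "\<And>x y. summable (\<lambda>n. (((Lam j f L) ^^ n) \<epsilon> x y) powr \<theta>)"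
  shows "\<exists>\<psi>. (\<forall>x. tendsto2 q (\<lambda>n. (T ^^ n) \<phi> x) (\<psi> x)) \<and>
           T \<psi> = \<psi> \<and>
           (\<exists>K>0. \<forall>x y. q (\<phi> x - \<psi> x) y powr \<theta> \<le> K * eps_star \<theta> j f L \<epsilon> x y) \<and>
           ((\<exists>M>0. \<forall>x y. summable (\<lambda>n. ((Lam j f L) ^^ n) \<epsilon> x y) \<and>
               eps_star \<theta> j f L \<epsilon> x y \<le> (M * (\<Sum>n. ((Lam j f L) ^^ n) \<epsilon> x y)) powr \<theta>) \<longrightarrow>
            (\<forall>\<xi>. T \<xi> = \<xi> \<and>
               (\<exists>K>0. \<forall>x y. q (\<phi> x - \<xi> x) y powr \<theta> \<le> K * eps_star \<theta> j f L \<epsilon> x y) \<longrightarrow>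
               \<xi> = \<psi>))"
proof -
  interpret quasi_2_beta_Banach_space scale \<beta> q \<kappa>
    by fact
  note theta = assms(5)
  note T_lemmas = assms(3,4)
  let ?a = "\<lambda>n x y. (Lam j f L ^^ n) \<epsilon> x y"
  have pos: "0 < \<theta>"
    by (rule theta_pos[OF theta])
  have step: "q ((T ^^ Suc n) \<phi> x - (T ^^ n) \<phi> x) y \<le> ?a n x y" for n x y
    by (rule T_orbit_step[OF T_lemmas assms(7)])
  have "\<exists>l. tendsto2 q (\<lambda>n. (T ^^ n) \<phi> x) l" for x
    using Cauchy2_of_summable_steps[OF theta, where X = "\<lambda>n. (T ^^ n) \<phi> x" and a = "\<lambda>n. ?a n x"]
      step assms(8) by (intro complete) blast
  then obtain \<psi> where lim: "\<And>x. tendsto2 q (\<lambda>n. (T ^^ n) \<phi> x) (\<psi> x)"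
    by metis
  have fixed: "T \<psi> = \<psi>"
    by (rule orbit_limit_fixed[OF T_lemmas lim])
  have "q (\<phi> x - \<psi> x) y powr \<theta> \<le> 8 * eps_star \<theta> j f L \<epsilon> x y" for x y
    using q_powr_limit_bound[OF theta step assms(8) lim, of x y] by (simp add: eps_star_def)
  then have bound: "\<exists>K>0. \<forall>x y. q (\<phi> x - \<psi> x) y powr \<theta> \<le> K * eps_star \<theta> j f L \<epsilon> x y"
    by (intro exI[of _ 8]) simp
  have unique: "\<xi> = \<psi>"
    if M: "\<forall>x y. summable (\<lambda>n. ?a n x y) \<and>
          eps_star \<theta> j f L \<epsilon> x y \<le> (M * (\<Sum>n. ?a n x y)) powr \<theta>"
      and K: "\<forall>x y. q (\<phi> x - \<xi> x) y powr \<theta> \<le> K * eps_star \<theta> j f L \<epsilon> x y"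
      and "0 < M" "0 < K" "T \<xi> = \<xi>"
    for M K \<xi>
  proof
    fix x
    have sum: "summable (\<lambda>n. ?a n x y)" for x y
      using M by simp
    \<comment> \<open>The \<open>\<theta>\<close>-th root of
      \<open>K * (M * S) powr \<theta>\<close> is \<open>C * S\<close>, where \<open>S\<close> is
      the series; this turns the estimate on powers into one on \<open>q\<close> itself.\<close>
    define C where "C = K powr (1 / \<theta>) * M"
    have "q (\<phi> x - \<xi> x) y \<le> C * (\<Sum>n. ?a n x y)" for x y
    proof -
      have nonneg: "0 \<le> (\<Sum>n. ?a n x y)"
        by (intro suminf_nonneg sum Lam_pow_nonneg assms(3,6))
      have "q (\<phi> x - \<xi> x) y powr \<theta> \<le> K * (M * (\<Sum>n. ?a n x y)) powr \<theta>"
        using M K \<open>K > 0\<close> by (meson mult_left_mono less_imp_le order_trans)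
      also have "\<dots> = (C * (\<Sum>n. ?a n x y)) powr \<theta>"
        using nonneg \<open>K > 0\<close> \<open>M > 0\<close> pos by (simp add: C_def powr_mult powr_powr mult.assoc)
      finally have "q (\<phi> x - \<xi> x) y powr \<theta> \<le> (C * (\<Sum>n. ?a n x y)) powr \<theta>" .
      moreover have "0 \<le> C * (\<Sum>n. ?a n x y)"
        using nonneg \<open>M > 0\<close> by (simp add: C_def)
      ultimately show ?thesis
        using powr_less_mono2[OF pos] by (meson not_le)
    qed
    \<comment> \<open>Both fixed points are thus limits of the same orbit of
      \<open>\<phi>\<close>.\<close>
    then have "tendsto2 q (\<lambda>n. (T ^^ n) \<phi> x) (\<xi> x)"
      using orbit_tendsto_fixed_point[OF T_lemmas sum] \<open>T \<xi> = \<xi>\<close> by blast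
    then show "\<xi> x = \<psi> x"
      using lim by (rule tendsto2_unique)
  qed
  show ?thesis
  proof (intro exI[of _ \<psi>] conjI allI impI)
    show "\<xi> = \<psi>"
      if "\<exists>M>0. \<forall>x y. summable (\<lambda>n. ?a n x y) \<and>
          eps_star \<theta> j f L \<epsilon> x y \<le> (M * (\<Sum>n. ?a n x y)) powr \<theta>"
        and "T \<xi> = \<xi> \<and> (\<exists>K>0. \<forall>x y. q (\<phi> x - \<xi> x) y powr \<theta> \<le> K * eps_star \<theta> j f L \<epsilon> x y)"
      for \<xi>
      using that by (elim exE conjE) (rule unique; assumption)
  qed (rule lim fixed bound)+
qed

end
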